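(* Suppose $\succsim$ is represented by $U(p)=\sum_{i=1}^n\mathrm{CE}(f[p_{A_i}],v^{A_i})$ for some partition $\{A_i\}_{i=1}^n$ of $I$ and indices $v^{A_1},\dots,v^{A_n}$. Then $\succsim$ satisfies independent-sources dominance if and only if it is represented by either $U(p)=\mathbb E^{f[p]}\,v$ for some $v$, or $U(p)=\sum_{i=1}^n\mathrm{CE}(f[p_{A_i}],v)$ for some $v$ that exhibits constant absolute risk aversion (CARA).
   Context: $N>1$ is an integer, $I=\{1,\dots,N\}$, $b>0$, $Z=[-b,b]$, $X=Z^N$, and for $A\subseteq I$, $X_A=Z^A$. $\Delta(Y)$ is the set of finitely supported probability measures on $Y$; $p_A$ is the marginal of $p\in\Delta(X)$ on the coordinates in $A$; $(p_1,\dots,p_N)$ denotes the product measure. $\succsim$ is a binary relation on $\Delta(X)$ with asymmetric part $\succ$ and symmetric part $\sim$; it is represented by $U$ if $p\succsim q\iff U(p)\geqslant U(q)$ for all $p,q\in\Delta(X)$. For $p\in\Delta(X_A)$, $f[p]$ is the distribution of the total $\sum_{i\in A}x_i$ when $x\sim p$. For a distribution $g$ with finite support in the domain of a continuous strictly increasing function $v$, $\mathbb E^g v$ is the expectation of $v$ under $g$ and $\mathrm{CE}(g,v)=v^{-1}(\mathbb E^g v)$ is the certainty equivalent. Each $v^{A_i}$ is a continuous, strictly increasing, twice continuously differentiable real function on $[-|A_i|b,|A_i|b]$ with positive derivative, so that the Arrow–Pratt measure of absolute risk aversion $-v''/v'$ is well defined; indices $v$ in the conclusion are of the same kind, defined on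 $[-Nb,Nb]$. $v$ exhibits CARA if $-v''/v'$ is constant. For finitely supported distributions $g,h$ on $\mathbb R$, $g\succ_{FOSD}h$ means $g\ne h$ and $\sum_{x\leqslant z}h(x)\geqslant\sum_{x\leqslant z}g(x)$ for all $z$. $\succsim$ satisfies independent-sources dominance if for all $p,q\in\Delta(X)$ of product form $p=(p_1,\dots,p_N)$, $q=(q_1,\dots,q_N)$: $f[p]=f[q]$ implies $p\sim q$, and $f[p]\succ_{FOSD}f[q]$ implies $p\succ q$. *)

theory Defs
  imports "HOL-Analysis.Analysis" "HOL-Probability.Probability" "HOL-Library.Disjoint_Sets"
begin

definition box_on :: "real \<Rightarrow> nat set \<Rightarrow> (nat \<Rightarrow> real) set" where
  "box_on b A = PiE A (\<lambda>_. {-b..b})"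

definition lotteries :: "'a set \<Rightarrow> 'a pmf set" where
  "lotteries Y = {p. finite (set_pmf p) \<and> set_pmf p \<subseteq> Y}"

definition marginal :: "nat set \<Rightarrow> (nat \<Rightarrow> real) pmf \<Rightarrow> (nat \<Rightarrow> real) pmf" where
  "marginal A p = map_pmf (\<lambda>x. restrict x A) p"

definition total_dist :: "nat set \<Rightarrow> (nat \<Rightarrow> real) pmf \<Rightarrow> real pmf" where
  "total_dist A p = map_pmf (\<lambda>x. \<Sum>i\<in>A. x i) p"

text \<open>An index with domain \<open>[-B, B]\<close> is a total function of which only the values on
  \<open>{-B..B}\<close> matter; all derivatives are taken within this interval, hence are one-sided
  at its endpoints.\<close>

definition deriv_in :: "real \<Rightarrow> (real \<Rightarrow> real) \<Rightarrow> real \<Rightarrow> real" where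
  "deriv_in B v x = vector_derivative v (at x within {-B..B})"

definition index_fun :: "real \<Rightarrow> (real \<Rightarrow> real) \<Rightarrow> bool" where
  "index_fun B v \<longleftrightarrow>
     continuous_on {-B..B} v \<and>
     strict_mono_on {-B..B} v \<and>
     v differentiable_on {-B..B} \<and>
     deriv_in B v differentiable_on {-B..B} \<and>
     continuous_on {-B..B} (deriv_in B (deriv_in B v)) \<and>
     (\<forall>x\<in>{-B..B}. deriv_in B v x > 0)"

definition arrow_pratt :: "real \<Rightarrow> (real \<Rightarrow> real) \<Rightarrow> real \<Rightarrow> real" where
  "arrow_pratt B v x = - deriv_in B (deriv_in B v) x / deriv_in B v x"

definition CARA :: "real \<Rightarrow> (real \<Rightarrow> real) \<Rightarrow> bool" where
  "CARA B v \<longleftrightarrow> (\<exists>c. \<forall>x\<in>{-B..B}. arrow_pratt B v x = c)"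

definition CE :: "real \<Rightarrow> real pmf \<Rightarrow> (real \<Rightarrow> real) \<Rightarrow> real" where
  "CE B g v = inv_into {-B..B} v (measure_pmf.expectation g v)"

text \<open>A preference is a predicate that is only ever inspected on \<open>lotteries (box_on b {1..N})\<close>.\<close>

type_synonym preference = "(nat \<Rightarrow> real) pmf \<Rightarrow> (nat \<Rightarrow> real) pmf \<Rightarrow> bool"

definition represents :: "nat \<Rightarrow> real \<Rightarrow> ((nat \<Rightarrow> real) pmf \<Rightarrow> real) \<Rightarrow> preference \<Rightarrow> bool" where
  "represents N b U R \<longleftrightarrow>
     (\<forall>p\<in>lotteries (box_on b {1..N}). \<forall>q\<in>lotteries (box_on b {1..N}). R p q \<longleftrightarrow> U p \<ge> U q)"

definition strict_pref :: "preference \<Rightarrow> preference" where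
  "strict_pref R p q \<longleftrightarrow> R p q \<and> \<not> R q p"

definition indiff :: "preference \<Rightarrow> preference" where
  "indiff R p q \<longleftrightarrow> R p q \<and> R q p"

definition FOSD :: "real pmf \<Rightarrow> real pmf \<Rightarrow> bool" where
  "FOSD g h \<longleftrightarrow> g \<noteq> h \<and> (\<forall>z. measure_pmf.prob h {..z} \<ge> measure_pmf.prob g {..z})"

text \<open>\<open>p\<close> is the product of its one-coordinate marginals, these being viewed as measures on
  the reals. The default value \<open>undefined\<close> makes the product live on extensional functions,
  as in \<^const>\<open>box_on\<close>.\<close>

definition product_form :: "nat \<Rightarrow> (nat \<Rightarrow> real) pmf \<Rightarrow> bool" where
  "product_form N p \<longleftrightarrow> p = Pi_pmf {1..N} undefined (\<lambda>i. map_pmf (\<lambda>x. x i) p)"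

definition independent_sources_dominance :: "nat \<Rightarrow> real \<Rightarrow> preference \<Rightarrow> bool" where
  "independent_sources_dominance N b R \<longleftrightarrow>
     (\<forall>p\<in>lotteries (box_on b {1..N}). \<forall>q\<in>lotteries (box_on b {1..N}).
        product_form N p \<longrightarrow> product_form N q \<longrightarrow>
          (total_dist {1..N} p = total_dist {1..N} q \<longrightarrow> indiff R p q) \<and>
          (FOSD (total_dist {1..N} p) (total_dist {1..N} q) \<longrightarrow> strict_pref R p q))"

end

theory Submission
  imports Defs
begin

text \<open>
  With at least two blocks, let the same small binary risk sit either on a source in
  \<open>A\<close> (constant total \<open>a\<close>) or on a source in \<open>C\<close> (constant total \<open>c\<close>). The overall totals
  have the same distribution, so by dominance the risk premium under \<open>v\<^sup>A\<close> at \<open>a\<close> equals the one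
  under \<open>v\<^sup>C\<close> at \<open>c\<close>. Agreement of the certainty equivalents of all lotteries on the two points
  \<open>\<plusminus>\<delta>\<close> already forces \<open>v\<^sup>C(c + t)\<close> to be an affine function of \<open>v\<^sup>A(a + t)\<close>, so no Taylor expansion
  is needed to see that the Arrow-Pratt measures agree. As \<open>a\<close> and \<open>c\<close> vary independently, all
  of them are one constant, and each index is affine in the same exponential (or linear) function.

  Conversely, under CARA certainty equivalents add up over independent summands, so on product
  lotteries both functionals are increasing in the expected utility of the total.
\<close>

declare One_nat_def [simp del]

section \<open>Expectations under finitely supported distributions\<close>

lemma lotteries_iff: "p \<in> lotteries Y \<longleftrightarrow> finite (set_pmf p) \<and> set_pmf p \<subseteq> Y"
  by (simp add: lotteries_def)

lemma expectation_eq_sum: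
  fixes v :: "'a \<Rightarrow> real"
  assumes "finite S" "set_pmf g \<subseteq> S"
  shows "measure_pmf.expectation g v = (\<Sum>x\<in>S. pmf g x * v x)"
  using assms by (subst integral_measure_pmf[of S]) auto

lemma expectation_affine:
  fixes v :: "'a \<Rightarrow> real"
  assumes "finite (set_pmf g)" "\<And>x. x \<in> set_pmf g \<Longrightarrow> w x = \<alpha> * v x + \<beta>"
  shows "measure_pmf.expectation g w = \<alpha> * measure_pmf.expectation g v + \<beta>"
proof -
  have "measure_pmf.expectation g w = (\<Sum>x\<in>set_pmf g. pmf g x * (\<alpha> * v x + \<beta>))"
    using assms by (subst expectation_eq_sum[OF assms(1)]) auto
  also have "\<dots> = \<alpha> * (\<Sum>x\<in>set_pmf g. pmf g x * v x) + (\<Sum>x\<in>set_pmf g. pmf g x) * \<beta>"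
    by (simp add: distrib_left sum.distrib sum_distrib_left sum_distrib_right mult_ac)
  also have "(\<Sum>x\<in>set_pmf g. pmf g x) = 1"
    using assms(1) by (intro sum_pmf_eq_1) auto
  finally show ?thesis
    using assms(1) by (simp add: expectation_eq_sum)
qed

subsection \<open>First-order stochastic dominance\<close>

text \<open>Summation by parts, peeling off the largest point of \<open>S\<close>.\<close>

lemma abel_sum_nonneg:
  fixes d v :: "real \<Rightarrow> real" and M :: real
  assumes "finite S" "strict_mono_on S v" "\<And>x. x \<in> S \<Longrightarrow> v x < M"
    and "\<And>z. (\<Sum>x\<in>S \<inter> {..z}. d x) \<le> 0"
  shows "(\<Sum>x\<in>S. d x * (v x - M)) \<ge> 0 \<and>
         ((\<Sum>x\<in>S. d x * (v x - M)) = 0 \<longrightarrow> (\<forall>x\<in>S. d x = 0))"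
  using assms
proof (induction S arbitrary: M rule: finite_linorder_max_induct)
  case empty
  then show ?case by simp
next
  case (insert m S)
  have notin: "m \<notin> S" using insert.hyps(2) by blast
  have vm: "v x < v m" if "x \<in> S" for x
    using insert.prems(1) insert.hyps(2) that by (auto simp: strict_mono_on_def)
  have le: "(\<Sum>x\<in>S \<inter> {..z}. d x) \<le> 0" for z
  proof (cases "z < m")
    case True
    then have "insert m S \<inter> {..z} = S \<inter> {..z}" by auto
    then show ?thesis using insert.prems(3)[of z] by simp
  next
    case False
    \<comment> \<open>For \<open>z\<close> at or above \<open>m\<close> the set is all of
      \<open>S\<close>. The cut-off on the right is at least every point of \<open>S\<close> and
      still below \<open>m\<close>; inserting \<open>m - 1\<close> keeps \<open>Max\<close>
      meaningful when \<open>S\<close> is empty.\<close>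
    have "S \<inter> {..z} = insert m S \<inter> {..Max (insert (m - 1) S)}"
    proof -
      have "Max (insert (m - 1) S) < m" using insert.hyps by auto
      moreover have "\<forall>x\<in>S. x \<le> Max (insert (m - 1) S)" using insert.hyps by auto
      moreover have "\<forall>x\<in>S. x \<le> z" using False insert.hyps(2) by fastforce
      ultimately show ?thesis by auto
    qed
    then show ?thesis using insert.prems(3)[of "Max (insert (m - 1) S)"] by simp
  qed
  have mono: "strict_mono_on S v"
    using insert.prems(1) by (auto simp: strict_mono_on_def)
  note IH = insert.IH[OF mono vm le]
  have "insert m S \<inter> {..m} = insert m S" using insert.hyps(2) by fastforce
  then have tot: "d m + (\<Sum>x\<in>S. d x) \<le> 0"
    using insert.prems(3)[of m] insert.hyps(1) notin by simp
  \<comment> \<open>Replacing the reference value \<open>M\<close> by \<open>v m\<close> removes the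
    term of \<open>m\<close> and leaves the form required by the induction hypothesis. The remainder
    is the total mass times \<open>v m - M\<close>, a product of a nonpositive and a negative
    number.\<close>
  have eq: "(\<Sum>x\<in>insert m S. d x * (v x - M)) =
      (\<Sum>x\<in>S. d x * (v x - v m)) + (d m + (\<Sum>x\<in>S. d x)) * (v m - M)"
  proof -
    have "(\<Sum>x\<in>S. d x * (v x - M)) = (\<Sum>x\<in>S. d x * (v x - v m) + d x * (v m - M))"
      by (intro sum.cong) (auto simp: algebra_simps)
    then show ?thesis
      using insert.hyps(1) notin
      by (simp add: sum.distrib sum_distrib_right[symmetric] distrib_right)
  qed
  have vM: "v m - M < 0" using insert.prems(2)[of m] by simp
  have pos: "(d m + (\<Sum>x\<in>S. d x)) * (v m - M) \<ge> 0"
    using tot vM by (simp add: mult_nonpos_nonpos)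
  show ?case
  proof (intro conjI impI)
    show "0 \<le> (\<Sum>x\<in>insert m S. d x * (v x - M))"
      unfolding eq using IH pos by simp
    assume "(\<Sum>x\<in>insert m S. d x * (v x - M)) = 0"
    then have "(\<Sum>x\<in>S. d x * (v x - v m)) = 0" "(d m + (\<Sum>x\<in>S. d x)) * (v m - M) = 0"
      unfolding eq using IH pos by linarith+
    with IH vM have "\<forall>x\<in>S. d x = 0" "d m + (\<Sum>x\<in>S. d x) = 0" by auto
    then show "\<forall>x\<in>insert m S. d x = 0" by simp
  qed
qed

text \<open>Summation by parts is applied to the difference of the two mass functions, whose partial
  sums are nonpositive by dominance. Its total is 0, so the reference value \<open>M\<close> drops
  out; strictness comes from the equality case, since \<open>g\<close> and \<open>h\<close>
  differ.\<close>

lemma FOSD_expectation_less: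
  fixes v :: "real \<Rightarrow> real"
  assumes g: "g \<in> lotteries D" and h: "h \<in> lotteries D"
    and v: "strict_mono_on D v" and "FOSD g h"
  shows "measure_pmf.expectation h v < measure_pmf.expectation g v"
proof -
  define S where "S = set_pmf g \<union> set_pmf h"
  have S: "finite S" "set_pmf g \<subseteq> S" "set_pmf h \<subseteq> S" "S \<subseteq> D"
    using g h by (auto simp: S_def lotteries_iff)
  define d where "d x = pmf g x - pmf h x" for x
  define M where "M = Max (v ` S) + 1"
  have M: "v x < M" if "x \<in> S" for x
  proof -
    have "v x \<le> Max (v ` S)" using that S(1) by (intro Max_ge) auto
    then show ?thesis by (simp add: M_def)
  qed
  have prob: "measure_pmf.prob r {..z} = (\<Sum>x\<in>S \<inter> {..z}. pmf r x)"
    if "set_pmf r \<subseteq> S" for r z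
  proof -
    have "measure_pmf.prob r {..z} = measure_pmf.prob r ({..z} \<inter> set_pmf r)"
      by (simp add: measure_Int_set_pmf)
    also have "\<dots> = measure_pmf.prob r ((S \<inter> {..z}) \<inter> set_pmf r)"
      using that by (intro arg_cong[where f = "measure_pmf.prob r"]) auto
    also have "\<dots> = (\<Sum>x\<in>S \<inter> {..z}. pmf r x)"
      using S(1) by (simp only: measure_Int_set_pmf) (simp add: measure_measure_pmf_finite)
    finally show ?thesis .
  qed
  have le: "(\<Sum>x\<in>S \<inter> {..z}. d x) \<le> 0" for z
  proof -
    have "measure_pmf.prob g {..z} \<le> measure_pmf.prob h {..z}"
      using \<open>FOSD g h\<close> by (simp add: FOSD_def)
    then show ?thesis
      unfolding prob[OF S(2)] prob[OF S(3)] by (simp add: d_def sum_subtractf)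
  qed
  have mono: "strict_mono_on S v"
    using v S(4) by (auto simp: strict_mono_on_def subset_iff)
  note abel = abel_sum_nonneg[OF S(1) mono M le]
  have sum0: "(\<Sum>x\<in>S. d x) = 0"
    using S by (simp add: d_def sum_subtractf sum_pmf_eq_1)
  have "(\<Sum>x\<in>S. d x * (v x - M)) = (\<Sum>x\<in>S. d x * v x) - (\<Sum>x\<in>S. d x) * M"
    by (simp add: right_diff_distrib sum_subtractf sum_distrib_right)
  also have "\<dots> = measure_pmf.expectation g v - measure_pmf.expectation h v"
    unfolding sum0 using S by (simp add: expectation_eq_sum[of S] d_def left_diff_distrib sum_subtractf)
  finally have eq: "(\<Sum>x\<in>S. d x * (v x - M)) =
      measure_pmf.expectation g v - measure_pmf.expectation h v" .
  have "\<not> (\<forall>x\<in>S. d x = 0)"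
  proof
    assume z: "\<forall>x\<in>S. d x = 0"
    have "pmf g x = pmf h x" for x
    proof (cases "x \<in> S")
      case False
      then have "x \<notin> set_pmf g" "x \<notin> set_pmf h" using S by auto
      then show ?thesis by (simp add: set_pmf_iff)
    qed (use z in \<open>simp add: d_def\<close>)
    then have "g = h" by (intro pmf_eqI)
    with \<open>FOSD g h\<close> show False by (simp add: FOSD_def)
  qed
  with abel eq show ?thesis by (smt (verit))
qed

subsection \<open>Indices and certainty equivalents\<close>

lemma index_funD:
  assumes "index_fun B v"
  shows "continuous_on {-B..B} v" "strict_mono_on {-B..B} v"
    "continuous_on {-B..B} (deriv_in B v)" "\<And>x. x \<in> {-B..B} \<Longrightarrow> deriv_in B v x > 0"
  using assms by (auto simp: index_fun_def intro: differentiable_imp_continuous_on)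

text \<open>At interior points the derivative within the interval is an ordinary two-sided one,
  which opens the usual \<open>DERIV\<close> calculus.\<close>

lemma index_fun_DERIV:
  assumes "index_fun B v" "-B < x" "x < B"
  shows "(v has_real_derivative deriv_in B v x) (at x)"
    "(deriv_in B v has_real_derivative deriv_in B (deriv_in B v) x) (at x)"
proof -
  have at: "at x within {-B..B} = at x"
    using assms(2,3) by (intro at_within_interior) auto
  have "v differentiable (at x within {-B..B})"
    "deriv_in B v differentiable (at x within {-B..B})"
    using assms unfolding index_fun_def differentiable_on_def by auto
  then show "(v has_real_derivative deriv_in B v x) (at x)"
    "(deriv_in B v has_real_derivative deriv_in B (deriv_in B v) x) (at x)"
    unfolding deriv_in_def[of B v x] deriv_in_def[of B "deriv_in B v" x]
    by (simp_all add: at has_real_derivative_iff_has_vector_derivative vector_derivative_works)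
qed

text \<open>\<open>inv_into\<close> is meaningful only on the image of \<open>v\<close>. By
  monotonicity the expectation lies between \<open>v (-B)\<close> and \<open>v B\<close>, and the
  intermediate value theorem puts it in that image.\<close>

lemma CE_works:
  assumes v: "index_fun B v" and g: "g \<in> lotteries {-B..B}"
  shows "CE B g v \<in> {-B..B}" "v (CE B g v) = measure_pmf.expectation g v"
proof -
  have fin: "finite (set_pmf g)" and sub: "set_pmf g \<subseteq> {-B..B}"
    using g by (auto simp: lotteries_iff)
  have "-B \<le> B" using sub set_pmf_not_empty[of g] by fastforce
  have mono: "v x \<le> v y" if "x \<in> {-B..B}" "y \<in> {-B..B}" "x \<le> y" for x y
    using index_funD(2)[OF v] that by (metis order_le_less strict_mono_onD)
  have int: "integrable (measure_pmf g) v" "integrable (measure_pmf g) (\<lambda>_. c)" for c :: real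
    using fin by (auto intro: integrable_measure_pmf_finite)
  have "measure_pmf.expectation g (\<lambda>_. v (-B)) \<le> measure_pmf.expectation g v"
    using sub mono \<open>-B \<le> B\<close> by (intro integral_mono_AE int) (auto simp: AE_measure_pmf_iff)
  moreover have "measure_pmf.expectation g v \<le> measure_pmf.expectation g (\<lambda>_. v B)"
    using sub mono \<open>-B \<le> B\<close> by (intro integral_mono_AE int) (auto simp: AE_measure_pmf_iff)
  ultimately have "\<exists>x\<ge>-B. x \<le> B \<and> v x = measure_pmf.expectation g v"
    using \<open>-B \<le> B\<close> index_funD(1)[OF v] by (intro IVT') auto
  then have "measure_pmf.expectation g v \<in> v ` {-B..B}" by force
  then show "CE B g v \<in> {-B..B}" "v (CE B g v) = measure_pmf.expectation g v"
    unfolding CE_def by (rule inv_into_into, rule f_inv_into_f)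
qed

lemma CE_le_iff:
  assumes v: "index_fun B v" and g: "g \<in> lotteries {-B..B}" and h: "h \<in> lotteries {-B..B}"
  shows "CE B g v \<le> CE B h v \<longleftrightarrow> measure_pmf.expectation g v \<le> measure_pmf.expectation h v"
proof -
  note mono = strict_mono_onD[OF index_funD(2)[OF v]]
  have "measure_pmf.expectation g v = measure_pmf.expectation h v" if "CE B g v = CE B h v"
    using CE_works(2)[OF v g] CE_works(2)[OF v h] that by simp
  then show ?thesis
    using mono[OF CE_works(1)[OF v g] CE_works(1)[OF v h]] mono[OF CE_works(1)[OF v h] CE_works(1)[OF v g]]
    unfolding CE_works(2)[OF v g] CE_works(2)[OF v h]
    by (cases "CE B g v" "CE B h v" rule: linorder_cases) auto
qed

lemma CE_eqI:
  assumes "index_fun B v" "x \<in> {-B..B}" "measure_pmf.expectation g v = v x"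
  shows "CE B g v = x"
  unfolding CE_def assms(3)
  using assms(2) index_funD(2)[OF assms(1)] by (intro inv_into_f_f strict_mono_on_imp_inj_on)

lemma CE_return_pmf:
  assumes "index_fun B v" "x \<in> {-B..B}"
  shows "CE B (return_pmf x) v = x"
  using assms by (intro CE_eqI) auto

subsection \<open>Constant absolute risk aversion\<close>

text \<open>An antiderivative of \<open>exp (- c * x)\<close> for every \<open>c\<close>. Dividing
  by \<open>c\<close> keeps it increasing for either sign of \<open>c\<close>, so the linear and
  exponential cases share one derivative formula.\<close>

definition cara_fun :: "real \<Rightarrow> real \<Rightarrow> real" where
  "cara_fun c x = (if c = 0 then x else - exp (- c * x) / c)"

text \<open>For nonzero \<open>c\<close> this is the cumulant generating function at
  \<open>- c\<close>, divided by \<open>- c\<close>. No domain interval enters, so certainty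
  equivalents on different intervals can be compared through it.\<close>

definition cara_CE :: "real \<Rightarrow> real pmf \<Rightarrow> real" where
  "cara_CE c g = (if c = 0 then measure_pmf.expectation g (\<lambda>x. x)
     else - ln (measure_pmf.expectation g (\<lambda>x. exp (- c * x))) / c)"

lemma cara_fun_DERIV: "(cara_fun c has_real_derivative exp (- c * x)) (at x within S)"
  unfolding cara_fun_def by (cases "c = 0") (auto intro!: derivative_eq_intros)

lemma strict_mono_cara_fun: "strict_mono (cara_fun c)"
proof (rule strict_monoI)
  fix x y :: real
  assume "x < y"
  then show "cara_fun c x < cara_fun c y"
    by (rule DERIV_pos_imp_increasing) (use cara_fun_DERIV exp_gt_zero in blast)
qed

lemma cara_fun_cara_CE:
  assumes "finite (set_pmf g)"
  shows "cara_fun c (cara_CE c g) = measure_pmf.expectation g (cara_fun c)"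
proof (cases "c = 0")
  case True
  then show ?thesis by (simp add: cara_fun_def[abs_def] cara_CE_def)
next
  case False
  have "measure_pmf.expectation g (\<lambda>x. exp (- c * x)) > 0"
    unfolding expectation_eq_sum[OF assms order_refl]
    using assms by (intro sum_pos) (auto simp: set_pmf_not_empty pmf_positive)
  moreover have "measure_pmf.expectation g (cara_fun c) =
      (- 1 / c) * measure_pmf.expectation g (\<lambda>x. exp (- c * x)) + 0"
    using False by (intro expectation_affine[OF assms]) (simp add: cara_fun_def)
  ultimately show ?thesis
    using False by (simp add: cara_fun_def cara_CE_def)
qed

lemma deriv_in_eqI:
  assumes "B > 0" "x \<in> {-B..B}" "(v has_real_derivative d) (at x within {-B..B})"
  shows "deriv_in B v x = d"
  unfolding deriv_in_def using assms
  by (intro vector_derivative_within_closed_interval)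
    (auto simp: has_real_derivative_iff_has_vector_derivative)

lemma index_fun_cara_fun:
  assumes "B > 0"
  shows "index_fun B (cara_fun c)" "CARA B (cara_fun c)"
proof -
  have d1: "deriv_in B (cara_fun c) x = exp (- c * x)" if "x \<in> {-B..B}" for x
    using assms that cara_fun_DERIV by (rule deriv_in_eqI)
  \<comment> \<open>The first derivative is known to be the exponential only on the interval, so the
    second derivative is transferred along that equality instead of computed directly.\<close>
  have D2: "(deriv_in B (cara_fun c) has_real_derivative - c * exp (- c * x)) (at x within {-B..B})"
    if "x \<in> {-B..B}" for x
    unfolding has_real_derivative_iff_has_vector_derivative
  proof (rule has_vector_derivative_transform[OF that d1])
    show "((\<lambda>x. exp (- c * x)) has_vector_derivative - c * exp (- c * x)) (at x within {-B..B})"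
      unfolding has_real_derivative_iff_has_vector_derivative[symmetric]
      by (auto intro!: derivative_eq_intros)
  qed
  have d2: "deriv_in B (deriv_in B (cara_fun c)) x = - c * exp (- c * x)" if "x \<in> {-B..B}" for x
    using assms that D2[OF that] by (rule deriv_in_eqI)
  have "continuous_on {-B..B} (deriv_in B (deriv_in B (cara_fun c))) \<longleftrightarrow>
      continuous_on {-B..B} (\<lambda>x. - c * exp (- c * x))"
    by (intro continuous_on_cong) (auto simp: d2)
  then have cont2: "continuous_on {-B..B} (deriv_in B (deriv_in B (cara_fun c)))"
    by (auto intro!: continuous_intros)
  have "cara_fun c differentiable_on {-B..B}" "deriv_in B (cara_fun c) differentiable_on {-B..B}"
    unfolding differentiable_on_def real_differentiable_def using cara_fun_DERIV D2 by blast+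
  then show "index_fun B (cara_fun c)"
    unfolding index_fun_def using cont2 strict_mono_cara_fun[of c]
    by (auto simp: d1 strict_mono_on_def strict_mono_def intro: differentiable_imp_continuous_on)
  show "CARA B (cara_fun c)"
    unfolding CARA_def arrow_pratt_def by (intro exI[of _ c]) (simp add: d1 d2)
qed

text \<open>Integrating \<open>v'' = - c v'\<close> twice shows that \<open>v\<close> is a positive
  affine transform of \<open>cara_fun c\<close>, and such transforms leave certainty equivalents
  unchanged. The equation is assumed on the open interval; continuity of \<open>v\<close> and
  \<open>v'\<close> carries the conclusion to the endpoints.\<close>

lemma CE_eq_cara_CE:
  assumes "B > 0" and v: "index_fun B v"
    and ap: "\<And>x. -B < x \<Longrightarrow> x < B \<Longrightarrow> arrow_pratt B v x = c"
    and g: "g \<in> lotteries {-B..B}"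
  shows "CE B g v = cara_CE c g"
proof -
  \<comment> \<open>The differential equation makes \<open>v' * exp (c * x)\<close> constant;
    \<alpha> is its value at the left endpoint.\<close>
  define \<alpha> where "\<alpha> = deriv_in B v (-B) * exp (c * (-B))"
  have "\<alpha> > 0" using index_funD(4)[OF v, of "-B"] \<open>B > 0\<close> by (simp add: \<alpha>_def)
  have v': "deriv_in B v x * exp (c * x) = \<alpha>" if "-B \<le> x" "x \<le> B" for x
    unfolding \<alpha>_def
  proof (rule DERIV_isconst2[of "-B" B "\<lambda>x. deriv_in B v x * exp (c * x)"])
    show "continuous_on {-B..B} (\<lambda>x. deriv_in B v x * exp (c * x))"
      by (intro continuous_intros index_funD(3)[OF v])
    fix y assume y: "-B < y" "y < B"
    have "deriv_in B (deriv_in B v) y = - c * deriv_in B v y"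
      using ap[OF y] index_funD(4)[OF v, of y] y by (simp add: arrow_pratt_def field_simps)
    then show "((\<lambda>x. deriv_in B v x * exp (c * x)) has_real_derivative 0) (at y)"
      using index_fun_DERIV(2)[OF v y] by (auto intro!: derivative_eq_intros)
  qed (use that \<open>B > 0\<close> in auto)
  have "v x - \<alpha> * cara_fun c x = v (-B) - \<alpha> * cara_fun c (-B)" if "-B \<le> x" "x \<le> B" for x
  proof (rule DERIV_isconst2[of "-B" B "\<lambda>x. v x - \<alpha> * cara_fun c x"])
    show "continuous_on {-B..B} (\<lambda>x. v x - \<alpha> * cara_fun c x)"
      using index_funD(1)[OF v] index_funD(1)[OF index_fun_cara_fun(1)[OF \<open>B > 0\<close>]]
      by (intro continuous_intros) auto
    fix y assume y: "-B < y" "y < B"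
    have "deriv_in B v y = \<alpha> * exp (- c * y)"
      using v'[of y] y by (simp add: exp_minus field_simps)
    then show "((\<lambda>x. v x - \<alpha> * cara_fun c x) has_real_derivative 0) (at y)"
      using index_fun_DERIV(1)[OF v y] cara_fun_DERIV[of c y UNIV]
      by (auto intro!: derivative_eq_intros)
  qed (use that \<open>B > 0\<close> in auto)
  then obtain \<beta> where aff: "v x = \<alpha> * cara_fun c x + \<beta>" if "x \<in> {-B..B}" for x
    by (metis atLeastAtMost_iff add.commute diff_add_cancel)
  have fin: "finite (set_pmf g)" and sub: "set_pmf g \<subseteq> {-B..B}"
    using g by (auto simp: lotteries_iff)
  have "\<alpha> * cara_fun c (CE B g v) + \<beta> = measure_pmf.expectation g v"
    using CE_works[OF v g] aff by simp
  also have "\<dots> = \<alpha> * measure_pmf.expectation g (cara_fun c) + \<beta>"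
    using sub aff by (intro expectation_affine[OF fin]) blast
  finally have "cara_fun c (CE B g v) = cara_fun c (cara_CE c g)"
    using \<open>\<alpha> > 0\<close> cara_fun_cara_CE[OF fin] by simp
  then show ?thesis
    using strict_mono_cara_fun by (simp add: strict_mono_eq)
qed

text \<open>Moment generating functions of independent summands multiply.\<close>

lemma cara_CE_total_dist:
  assumes p: "p \<in> lotteries (box_on b {1..N})" and prod: "product_form N p"
    and A: "A \<subseteq> {1..N}"
  shows "cara_CE c (total_dist A p) = (\<Sum>i\<in>A. cara_CE c (map_pmf (\<lambda>x. x i) p))"
proof (cases "c = 0")
  case True
  have "integrable (measure_pmf p) (\<lambda>x. x i)" for i
    using p by (auto simp: lotteries_iff intro: integrable_measure_pmf_finite)
  with True show ?thesis by (simp add: cara_CE_def total_dist_def)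
next
  case False
  \<comment> \<open>The moment generating function of source \<open>i\<close> at
    \<open>- c\<close>.\<close>
  define m where "m i = measure_pmf.expectation p (\<lambda>x. exp (- c * x i))" for i
  have fin: "finite (set_pmf p)" using p by (simp add: lotteries_iff)
  have "finite A" using A finite_subset by blast
  have m_pos: "m i > 0" for i
    unfolding m_def expectation_eq_sum[OF fin order_refl]
    using fin by (intro sum_pos) (auto simp: set_pmf_not_empty pmf_positive)
  \<comment> \<open>The product rule for \<open>Pi_pmf\<close> runs over all coordinates, so a
    product over \<open>A\<close> is padded with factors 1.\<close>
  have restr: "prod h A = (\<Prod>i\<in>{1..N}. if i \<in> A then h i else 1)" for h :: "nat \<Rightarrow> real"
  proof -
    have "A = {1..N} \<inter> A" using A by auto
    then show ?thesis by (metis prod.inter_restrict finite_atLeastAtMost)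
  qed
  let ?q = "Pi_pmf {1..N} undefined (\<lambda>i. map_pmf (\<lambda>x. x i) p)"
  have "measure_pmf.expectation p (\<lambda>x. exp (- c * (\<Sum>i\<in>A. x i))) =
      measure_pmf.expectation p (\<lambda>x. \<Prod>i\<in>A. exp (- c * x i))"
    by (simp only: sum_distrib_left exp_sum[OF \<open>finite A\<close>])
  also have "\<dots> = measure_pmf.expectation ?q
      (\<lambda>x. \<Prod>i\<in>{1..N}. (\<lambda>i t. if i \<in> A then exp (- c * t) else 1) i (x i))"
    using prod by (simp only: product_form_def[symmetric] restr) (simp add: product_form_def)
  also have "\<dots> = (\<Prod>i\<in>{1..N}. measure_pmf.expectation (map_pmf (\<lambda>x. x i) p)
      (\<lambda>t. if i \<in> A then exp (- c * t) else 1))"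
    using fin by (intro expectation_prod_Pi_pmf) (auto intro!: integrable_measure_pmf_finite)
  also have "\<dots> = (\<Prod>i\<in>A. m i)"
    unfolding restr by (intro prod.cong) (auto simp: m_def)
  finally have "measure_pmf.expectation p (\<lambda>x. exp (- c * (\<Sum>i\<in>A. x i))) = (\<Prod>i\<in>A. m i)" .
  then have "cara_CE c (total_dist A p) = - ln (\<Prod>i\<in>A. m i) / c"
    using False by (simp add: cara_CE_def total_dist_def)
  also have "ln (\<Prod>i\<in>A. m i) = (\<Sum>i\<in>A. ln (m i))"
    using m_pos \<open>finite A\<close> by (intro ln_prod) (auto simp: order_less_le)
  also have "- (\<Sum>i\<in>A. ln (m i)) / c = (\<Sum>i\<in>A. - ln (m i) / c)"
    by (simp add: sum_negf sum_divide_distrib)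
  also have "\<dots> = (\<Sum>i\<in>A. cara_CE c (map_pmf (\<lambda>x. x i) p))"
    using False by (simp add: cara_CE_def m_def)
  finally show ?thesis .
qed

subsection \<open>Independent-sources dominance under CARA\<close>

lemma total_dist_marginal: "total_dist A (marginal A p) = total_dist A p"
  by (simp add: total_dist_def marginal_def map_pmf_comp)

text \<open>The slack in \<open>B\<close> lets one bound serve both the block's own interval and the
  common interval from \<open>- N * b\<close> to \<open>N * b\<close>.\<close>

lemma total_dist_lottery:
  assumes "p \<in> lotteries (box_on b I)" "A \<subseteq> I" "real (card A) * b \<le> B"
  shows "total_dist A p \<in> lotteries {-B..B}"
proof -
  have "\<bar>\<Sum>i\<in>A. x i\<bar> \<le> B" if "x \<in> set_pmf p" for x
  proof -
    have "\<bar>x i\<bar> \<le> b" if "i \<in> A" for i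
      using assms(1,2) \<open>x \<in> set_pmf p\<close> that
      by (fastforce simp: lotteries_iff box_on_def PiE_iff abs_le_iff)
    then have "(\<Sum>i\<in>A. \<bar>x i\<bar>) \<le> real (card A) * b"
      by (rule sum_bounded_above)
    with assms(3) show ?thesis
      using sum_abs[of x A] by linarith
  qed
  then show ?thesis
    using assms(1) by (force simp: lotteries_iff total_dist_def abs_le_iff)
qed

lemma partition_sum:
  assumes "partition_on I P" "finite I"
  shows "(\<Sum>A\<in>P. sum h A) = sum h I"
proof -
  have "\<forall>A\<in>P. finite A"
    using assms by (auto simp: partition_on_def intro: finite_subset)
  moreover have "\<forall>A\<in>P. \<forall>C\<in>P. A \<noteq> C \<longrightarrow> A \<inter> C = {}"
    using assms(1) by (simp add: partition_on_def disjoint_def)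
  ultimately have "sum h (\<Union>P) = (\<Sum>A\<in>P. sum h A)"
    by (simp add: sum.Union_disjoint)
  then show ?thesis
    using assms(1) by (simp add: partition_on_def)
qed

text \<open>A strictly increasing \<open>v\<close> ranks dominating totals strictly.
  \<open>R\<close> is tied to expected utility on product lotteries only, so the lemma also covers
  the CARA functional, which is shown to rank like expected utility just there.\<close>

lemma dominance_of_expected_utility:
  fixes v :: "real \<Rightarrow> real"
  assumes "N \<ge> 1"
    and v: "strict_mono_on {-(real N * b)..real N * b} v"
    and R: "\<And>p q. p \<in> lotteries (box_on b {1..N}) \<Longrightarrow> q \<in> lotteries (box_on b {1..N}) \<Longrightarrow>
      product_form N p \<Longrightarrow> product_form N q \<Longrightarrow>
      R p q \<longleftrightarrow> measure_pmf.expectation (total_dist {1..N} p) v \<ge>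
                measure_pmf.expectation (total_dist {1..N} q) v"
  shows "independent_sources_dominance N b R"
  unfolding independent_sources_dominance_def
proof (intro ballI impI conjI)
  fix p q
  assume pq: "p \<in> lotteries (box_on b {1..N})" "q \<in> lotteries (box_on b {1..N})"
    "product_form N p" "product_form N q"
  {
    assume "total_dist {1..N} p = total_dist {1..N} q"
    with pq show "indiff R p q" by (simp add: indiff_def R)
  next
    assume "FOSD (total_dist {1..N} p) (total_dist {1..N} q)"
    with v have "measure_pmf.expectation (total_dist {1..N} q) v <
        measure_pmf.expectation (total_dist {1..N} p) v"
      using pq by (intro FOSD_expectation_less[of _ "{-(real N * b)..real N * b}"] total_dist_lottery) auto
    with pq show "strict_pref R p q" by (simp add: strict_pref_def R)
  }
qed

lemma dominance_of_CARA:
  assumes "N \<ge> 1" "b > 0" and part: "partition_on {1..N} P"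
    and v: "index_fun (real N * b) v" "CARA (real N * b) v"
    and R: "represents N b (\<lambda>p. \<Sum>A\<in>P. CE (real N * b) (total_dist A (marginal A p)) v) R"
  shows "independent_sources_dominance N b R"
proof (rule dominance_of_expected_utility[OF \<open>N \<ge> 1\<close> index_funD(2)[OF v(1)]])
  let ?B = "real N * b"
  have "?B > 0" using assms by simp
  obtain c where c: "\<And>x. x \<in> {-?B..?B} \<Longrightarrow> arrow_pratt ?B v x = c"
    using v(2) by (auto simp: CARA_def)
  have CE: "CE ?B g v = cara_CE c g" if "g \<in> lotteries {-?B..?B}" for g
    using CE_eq_cara_CE[OF \<open>?B > 0\<close> v(1) _ that] c by simp
  have lot: "total_dist A p \<in> lotteries {-?B..?B}"
    if "p \<in> lotteries (box_on b {1..N})" "A \<subseteq> {1..N}" for p A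
    using that \<open>b > 0\<close> card_mono[OF _ that(2)] by (intro total_dist_lottery) auto
  \<comment> \<open>On product lotteries each block's certainty equivalent splits into those of its
    sources, and these recombine over all of \<open>{1..N}\<close>; the partition
    disappears.\<close>
  have U: "(\<Sum>A\<in>P. CE ?B (total_dist A (marginal A p)) v) = CE ?B (total_dist {1..N} p) v"
    if p: "p \<in> lotteries (box_on b {1..N})" and prod: "product_form N p" for p
  proof -
    have sub: "A \<subseteq> {1..N}" if "A \<in> P" for A
      using part that by (auto simp: partition_on_def)
    have "(\<Sum>A\<in>P. CE ?B (total_dist A (marginal A p)) v) =
        (\<Sum>A\<in>P. \<Sum>i\<in>A. cara_CE c (map_pmf (\<lambda>x. x i) p))"
      using sub by (intro sum.cong)
        (auto simp: total_dist_marginal CE lot p cara_CE_total_dist[OF p prod])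
    also have "\<dots> = (\<Sum>i\<in>{1..N}. cara_CE c (map_pmf (\<lambda>x. x i) p))"
      by (intro partition_sum[OF part]) auto
    also have "\<dots> = CE ?B (total_dist {1..N} p) v"
      by (simp add: CE lot p cara_CE_total_dist[OF p prod])
    finally show ?thesis .
  qed
  fix p q
  assume pq: "p \<in> lotteries (box_on b {1..N})" "q \<in> lotteries (box_on b {1..N})"
    "product_form N p" "product_form N q"
  have "R p q \<longleftrightarrow> CE ?B (total_dist {1..N} q) v \<le> CE ?B (total_dist {1..N} p) v"
    using R pq by (simp add: represents_def U)
  also have "\<dots> \<longleftrightarrow> measure_pmf.expectation (total_dist {1..N} q) v \<le>
      measure_pmf.expectation (total_dist {1..N} p) v"
    using pq by (intro CE_le_iff[OF v(1)] lot) auto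
  finally show "R p q \<longleftrightarrow> measure_pmf.expectation (total_dist {1..N} q) v \<le>
      measure_pmf.expectation (total_dist {1..N} p) v" .
qed

subsection \<open>Moving a risk between sources\<close>

text \<open>A sure baseline \<open>x\<close> with one shock \<open>e\<close> on source
  \<open>i\<close>. Outside \<open>{1..N}\<close> \<open>restrict\<close> yields
  \<open>undefined\<close>, the default value of \<open>product_form\<close>.\<close>

definition risk_at :: "nat \<Rightarrow> (nat \<Rightarrow> real) \<Rightarrow> nat \<Rightarrow> real pmf \<Rightarrow> (nat \<Rightarrow> real) pmf" where
  "risk_at N x i e = map_pmf (\<lambda>t. restrict (x(i := x i + t)) {1..N}) e"

lemma risk_at_lottery:
  assumes "finite (set_pmf e)" "\<And>k. k \<in> {1..N} \<Longrightarrow> x k \<in> {-b..b}"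
    and "\<And>t. t \<in> set_pmf e \<Longrightarrow> x i + t \<in> {-b..b}"
  shows "risk_at N x i e \<in> lotteries (box_on b {1..N})"
proof -
  have "restrict (x(i := x i + t)) {1..N} \<in> box_on b {1..N}" if "t \<in> set_pmf e" for t
    unfolding box_on_def restrict_PiE_iff using assms(2,3) that by simp
  then show ?thesis
    using assms(1) by (auto simp: lotteries_iff risk_at_def)
qed

text \<open>Only coordinate \<open>i\<close> is random, so the product of the other marginals is a
  point mass.\<close>

lemma product_form_risk_at:
  assumes "i \<in> {1..N}"
  shows "product_form N (risk_at N x i e)"
proof -
  define A where "A = {1..N} - {i}"
  have I: "{1..N} = insert i A" "finite A" "i \<notin> A" using assms by (auto simp: A_def)
  let ?p = "risk_at N x i e"
  have "Pi_pmf A undefined (\<lambda>k. map_pmf (\<lambda>x. x k) ?p) = Pi_pmf A undefined (\<lambda>k. return_pmf (x k))"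
    using I by (intro Pi_pmf_cong) (auto simp: risk_at_def map_pmf_comp A_def map_pmf_const)
  also have "\<dots> = return_pmf (restrict x A)"
    using I(2) by (simp add: restrict_def)
  finally have "Pi_pmf (insert i A) undefined (\<lambda>k. map_pmf (\<lambda>x. x k) ?p) =
      map_pmf (\<lambda>y. (restrict x A)(i := y)) (map_pmf (\<lambda>x. x i) ?p)"
    using I by (simp add: Pi_pmf_insert pair_return_pmf2 map_pmf_comp)
  also have "\<dots> = ?p"
    using assms unfolding risk_at_def map_pmf_comp
    by (intro map_pmf_cong) (auto simp: fun_eq_iff A_def restrict_def)
  finally show ?thesis by (simp add: product_form_def I(1))
qed

lemma total_dist_risk_at:
  assumes "A \<subseteq> {1..N}"
  shows "total_dist A (risk_at N x i e) =
    (if i \<in> A then map_pmf (\<lambda>t. (\<Sum>k\<in>A. x k) + t) e else return_pmf (\<Sum>k\<in>A. x k))"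
proof -
  have "finite A" using assms finite_subset by blast
  have 1: "(\<Sum>k\<in>A. restrict (x(i := x i + t)) {1..N} k) = (\<Sum>k\<in>A. x k) + t" if "i \<in> A" for t
  proof -
    have "(\<Sum>k\<in>A. restrict (x(i := x i + t)) {1..N} k) = (\<Sum>k\<in>A. x k + (if k = i then t else 0))"
      using assms by (intro sum.cong) auto
    then show ?thesis using \<open>finite A\<close> that by (simp add: sum.distrib)
  qed
  have 2: "(\<Sum>k\<in>A. restrict (x(i := x i + t)) {1..N} k) = (\<Sum>k\<in>A. x k)" if "i \<notin> A" for t
    using assms that by (intro sum.cong) auto
  show ?thesis
  proof (cases "i \<in> A")
    case True
    then show ?thesis
      by (simp only: total_dist_def risk_at_def map_pmf_comp 1 if_True)
  next
    case False
    then show ?thesis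
      by (simp only: total_dist_def risk_at_def map_pmf_comp 2 if_False map_pmf_const not_False_eq_True)
  qed
qed

section \<open>From equal risk premia to equal Arrow-Pratt measures\<close>

text \<open>For each \<open>t\<close> choose the probability of +\<delta> that makes
  \<open>a + t\<close> the certainty equivalent under \<open>u\<close>. By hypothesis the same
  probability makes \<open>c + t\<close> the certainty equivalent under \<open>w\<close>. This
  probability is an affine function of \<open>u (a + t)\<close>, and \<open>w (c + t)\<close> is an
  affine function of it.\<close>

lemma affine_of_binary_CE_eq:
  assumes u: "index_fun B u" and w: "index_fun B' w" and "\<delta> > 0"
    and a: "{a-\<delta>..a+\<delta>} \<subseteq> {-B..B}" and c: "{c-\<delta>..c+\<delta>} \<subseteq> {-B'..B'}"
    and CE: "\<And>e. set_pmf e \<subseteq> {-\<delta>, \<delta>} \<Longrightarrow>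
      CE B (map_pmf (\<lambda>t. a + t) e) u - a = CE B' (map_pmf (\<lambda>t. c + t) e) w - c"
  obtains m n where "m > 0" "\<And>t. \<bar>t\<bar> \<le> \<delta> \<Longrightarrow> w (c + t) = m * u (a + t) + n"
proof -
  have mem: "a + t \<in> {-B..B}" "c + t \<in> {-B'..B'}" if "\<bar>t\<bar> \<le> \<delta>" for t
    using a c that by (auto simp: subset_iff abs_le_iff)
  have umono: "u (a + s) < u (a + t)" if "s < t" "\<bar>s\<bar> \<le> \<delta>" "\<bar>t\<bar> \<le> \<delta>" for s t
    using strict_mono_onD[OF index_funD(2)[OF u]] mem that by simp
  have wmono: "w (c + s) < w (c + t)" if "s < t" "\<bar>s\<bar> \<le> \<delta>" "\<bar>t\<bar> \<le> \<delta>" for s t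
    using strict_mono_onD[OF index_funD(2)[OF w]] mem that by simp
  define k where "k = u (a + \<delta>) - u (a - \<delta>)"
  define l where "l = w (c + \<delta>) - w (c - \<delta>)"
  have "k > 0" "l > 0"
    using umono[of "-\<delta>" \<delta>] wmono[of "-\<delta>" \<delta>] \<open>\<delta> > 0\<close> by (auto simp: k_def l_def)
  have key: "w (c + t) = l * ((u (a + t) - u (a - \<delta>)) / k) + w (c - \<delta>)" if t: "\<bar>t\<bar> \<le> \<delta>" for t
  proof -
    \<comment> \<open>The solution of \<open>s * u (a + \<delta>) + (1 - s) * u (a - \<delta>) = u
      (a + t)\<close>.\<close>
    define s where "s = (u (a + t) - u (a - \<delta>)) / k"
    have "u (a - \<delta>) \<le> u (a + t)" "u (a + t) \<le> u (a + \<delta>)"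
      using umono[of "-\<delta>" t] umono[of t \<delta>] t \<open>\<delta> > 0\<close>
      by (cases "t = -\<delta>"; cases "t = \<delta>"; force)+
    then have s: "0 \<le> s" "s \<le> 1"
      using \<open>k > 0\<close> by (auto simp: s_def k_def)
    define e where "e = map_pmf (\<lambda>r. if r then \<delta> else -\<delta>) (bernoulli_pmf s)"
    have sub: "set_pmf e \<subseteq> {-\<delta>, \<delta>}" by (auto simp: e_def)
    have "CE B (map_pmf (\<lambda>t. a + t) e) u = a + t"
    proof (rule CE_eqI[OF u])
      have "s * k = u (a + t) - u (a - \<delta>)" using \<open>k > 0\<close> by (simp add: s_def)
      then show "measure_pmf.expectation (map_pmf (\<lambda>t. a + t) e) u = u (a + t)"
        using s by (simp add: e_def k_def algebra_simps)
    qed (use mem t in auto)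
    then have "CE B' (map_pmf (\<lambda>t. c + t) e) w = c + t" using CE[OF sub] by simp
    moreover have "map_pmf (\<lambda>t. c + t) e \<in> lotteries {-B'..B'}"
      using finite_subset[OF sub] sub mem(2)[of \<delta>] mem(2)[of "-\<delta>"] \<open>\<delta> > 0\<close>
      by (auto simp: lotteries_iff)
    ultimately have "w (c + t) = measure_pmf.expectation (map_pmf (\<lambda>t. c + t) e) w"
      using CE_works(2)[OF w] by metis
    also have "\<dots> = l * s + w (c - \<delta>)"
      using s by (simp add: e_def l_def algebra_simps)
    finally show ?thesis by (simp add: s_def)
  qed
  show thesis
  proof (rule that[of "l / k"])
    show "l / k > 0" using \<open>k > 0\<close> \<open>l > 0\<close> by simp
    show "w (c + t) = l / k * u (a + t) + (w (c - \<delta>) - l * u (a - \<delta>) / k)" if "\<bar>t\<bar> \<le> \<delta>" for t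
      using key[OF that] \<open>k > 0\<close> by (simp add: field_simps)
  qed
qed

text \<open>The indices have different domains and base points, so both are differentiated in the
  common displacement \<open>t\<close>; the factor \<open>m\<close> then cancels in the
  ratio.\<close>

lemma arrow_pratt_eq_of_affine:
  assumes u: "index_fun B u" and w: "index_fun B' w" and "\<delta> > 0" "m > 0"
    and a: "{a-\<delta>..a+\<delta>} \<subseteq> {-B..B}" and c: "{c-\<delta>..c+\<delta>} \<subseteq> {-B'..B'}"
    and aff: "\<And>t. \<bar>t\<bar> \<le> \<delta> \<Longrightarrow> w (c + t) = m * u (a + t) + n"
  shows "arrow_pratt B u a = arrow_pratt B' w c"
proof -
  have mem: "-B < a + t" "a + t < B" "-B' < c + t" "c + t < B'" if "\<bar>t\<bar> < \<delta>" for t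
  proof -
    have "a - \<delta> \<in> {-B..B}" "a + \<delta> \<in> {-B..B}" "c - \<delta> \<in> {-B'..B'}" "c + \<delta> \<in> {-B'..B'}"
      using a c \<open>\<delta> > 0\<close> by (auto simp: subset_iff)
    then show "-B < a + t" "a + t < B" "-B' < c + t" "c + t < B'" using that by auto
  qed
  have shift: "((\<lambda>t. f (y + t)) has_real_derivative d) (at t)"
    if "(f has_real_derivative d) (at (y + t))" for f y d t
    using DERIV_shift[of f d t y] that by (simp add: add.commute)
  \<comment> \<open>An open set of displacements: the first derivatives must agree on a whole
    neighbourhood of 0 before that relation can be differentiated again.\<close>
  define S where "S = {-\<delta><..<\<delta>}"
  have S: "open S" "0 \<in> S" "\<And>t. t \<in> S \<Longrightarrow> \<bar>t\<bar> < \<delta>" using \<open>\<delta> > 0\<close> by (auto simp: S_def)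
  have d1: "deriv_in B' w (c + t) = m * deriv_in B u (a + t)" if "t \<in> S" for t
  proof -
    note t = S(3)[OF that]
    have "((\<lambda>t. u (a + t)) has_real_derivative deriv_in B u (a + t)) (at t)"
      by (intro shift index_fun_DERIV(1)[OF u] mem t)
    from DERIV_add[OF DERIV_cmult[OF this] DERIV_const]
    have "((\<lambda>t. m * u (a + t) + n) has_real_derivative m * deriv_in B u (a + t)) (at t)"
      by simp
    then have "((\<lambda>t. w (c + t)) has_real_derivative m * deriv_in B u (a + t)) (at t)"
      using S(1) that by (rule has_field_derivative_transform_within_open) (use aff S(3) in force)
    moreover have "((\<lambda>t. w (c + t)) has_real_derivative deriv_in B' w (c + t)) (at t)"
      by (intro shift index_fun_DERIV(1)[OF w] mem t)
    ultimately show ?thesis by (rule DERIV_unique[symmetric])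
  qed
  note z = S(3)[OF S(2)]
  have "((\<lambda>t. m * deriv_in B u (a + t)) has_real_derivative
      m * deriv_in B (deriv_in B u) (a + 0)) (at 0)"
    by (intro DERIV_cmult shift index_fun_DERIV(2)[OF u] mem z)
  then have "((\<lambda>t. deriv_in B' w (c + t)) has_real_derivative
      m * deriv_in B (deriv_in B u) (a + 0)) (at 0)"
    using S(1,2) by (rule has_field_derivative_transform_within_open) (use d1 in force)
  moreover have "((\<lambda>t. deriv_in B' w (c + t)) has_real_derivative
      deriv_in B' (deriv_in B' w) (c + 0)) (at 0)"
    by (intro shift index_fun_DERIV(2)[OF w] mem z)
  ultimately have "deriv_in B' (deriv_in B' w) c = m * deriv_in B (deriv_in B u) a"
    using DERIV_unique by fastforce
  with d1[OF S(2)] \<open>m > 0\<close> show ?thesis by (simp add: arrow_pratt_def)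
qed

section \<open>Consequences of dominance for at least two blocks\<close>

text \<open>Moving the shock from \<open>i\<close> to \<open>j\<close> preserves the distribution of
  the grand total, hence indifference. Blocks other than \<open>A\<close> and \<open>C\<close> keep
  the same sure total, and whichever of \<open>A\<close> and \<open>C\<close> is without the shock
  contributes its sure total; rearranging gives the claim.\<close>

lemma CE_shift_eq_of_dominance:
  assumes part: "partition_on {1..N} P"
    and vA: "\<forall>A\<in>P. index_fun (real (card A) * b) (vA A)"
    and R: "represents N b
           (\<lambda>p. \<Sum>A\<in>P. CE (real (card A) * b) (total_dist A (marginal A p)) (vA A)) R"
    and dom: "independent_sources_dominance N b R"
    and AC: "A \<in> P" "C \<in> P" "A \<noteq> C" and ij: "i \<in> A" "j \<in> C"
    and x: "\<And>k. k \<in> {1..N} \<Longrightarrow> x k \<in> {-b..b}"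
    and e: "finite (set_pmf e)"
      "\<And>t. t \<in> set_pmf e \<Longrightarrow> x i + t \<in> {-b..b}" "\<And>t. t \<in> set_pmf e \<Longrightarrow> x j + t \<in> {-b..b}"
  shows "CE (real (card A) * b) (map_pmf (\<lambda>t. sum x A + t) e) (vA A) - sum x A =
         CE (real (card C) * b) (map_pmf (\<lambda>t. sum x C + t) e) (vA C) - sum x C"
proof -
  define V where "V D g = CE (real (card D) * b) g (vA D)" for D g
  have sub: "D \<subseteq> {1..N}" if "D \<in> P" for D
    using part that by (auto simp: partition_on_def)
  have "finite P" using part finite_elements by blast
  have disj: "D \<inter> E = {}" if "D \<in> P" "E \<in> P" "D \<noteq> E" for D E
    using part that by (auto simp: partition_on_def disjoint_def)
  let ?p = "risk_at N x i e" and ?q = "risk_at N x j e"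
  have I: "i \<in> {1..N}" "j \<in> {1..N}" using sub[OF AC(1)] sub[OF AC(2)] ij by blast+
  have lot: "?p \<in> lotteries (box_on b {1..N})" "?q \<in> lotteries (box_on b {1..N})"
    by (rule risk_at_lottery, rule e(1), erule x, erule e)+
  have "total_dist {1..N} ?p = total_dist {1..N} ?q"
    using I by (simp add: total_dist_risk_at)
  with dom lot I have "indiff R ?p ?q"
    by (auto simp: independent_sources_dominance_def product_form_risk_at)
  then have "(\<Sum>D\<in>P. V D (total_dist D ?p)) = (\<Sum>D\<in>P. V D (total_dist D ?q))"
    using R lot by (auto simp: indiff_def represents_def total_dist_marginal V_def)
  moreover have "(\<Sum>D\<in>P. h D) = h A + h C + (\<Sum>D\<in>P - {A, C}. h D)" for h :: "nat set \<Rightarrow> real"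
    using \<open>finite P\<close> AC by (simp add: sum.remove[of P A] sum.remove[of "P - {A}" C] Diff_insert2[symmetric] add.assoc insert_commute)
  moreover have "(\<Sum>D\<in>P - {A, C}. V D (total_dist D ?p)) = (\<Sum>D\<in>P - {A, C}. V D (total_dist D ?q))"
  proof (intro sum.cong refl)
    fix D assume "D \<in> P - {A, C}"
    then have "i \<notin> D" "j \<notin> D" "D \<subseteq> {1..N}" using disj AC ij sub by auto
    then show "V D (total_dist D ?p) = V D (total_dist D ?q)" by (simp add: total_dist_risk_at)
  qed
  moreover have "i \<notin> C" "j \<notin> A" using disj[OF AC] ij by auto
  moreover have "V D (return_pmf (sum x D)) = sum x D" if "D \<in> P" for D
    unfolding V_def
  proof (rule CE_return_pmf)
    show "index_fun (real (card D) * b) (vA D)" using vA that by blast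
    have "(\<Sum>k\<in>D. x k) \<le> real (card D) * b" "real (card D) * (-b) \<le> (\<Sum>k\<in>D. x k)"
      using x sub[OF that] by (intro sum_bounded_above sum_bounded_below; fastforce)+
    then show "sum x D \<in> {- (real (card D) * b)..real (card D) * b}" by simp
  qed
  ultimately show ?thesis
    using AC ij sub by (simp add: total_dist_risk_at V_def)
qed

lemma arrow_pratt_eq_of_dominance:
  assumes part: "partition_on {1..N} P" and "b > 0"
    and vA: "\<forall>A\<in>P. index_fun (real (card A) * b) (vA A)"
    and R: "represents N b
           (\<lambda>p. \<Sum>A\<in>P. CE (real (card A) * b) (total_dist A (marginal A p)) (vA A)) R"
    and dom: "independent_sources_dominance N b R"
    and AC: "A \<in> P" "C \<in> P" "A \<noteq> C"
    and a: "\<bar>a\<bar> < real (card A) * b" and c: "\<bar>c\<bar> < real (card C) * b"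
  shows "arrow_pratt (real (card A) * b) (vA A) a = arrow_pratt (real (card C) * b) (vA C) c"
proof -
  have fin: "finite A" "finite C" "A \<inter> C = {}"
    using part AC by (auto simp: partition_on_def disjoint_def intro: finite_subset)
  have ne: "card A > 0" "card C > 0"
    using fin part AC by (auto simp: partition_on_def card_gt_0_iff)
  then obtain i j where ij: "i \<in> A" "j \<in> C" by (metis card_gt_0_iff ex_in_conv)
  \<comment> \<open>Each block total is spread evenly over its sources, which places every source
    strictly inside its range.\<close>
  define x where "x k = (if k \<in> A then a / card A else if k \<in> C then c / card C else 0)" for k
  have sA: "sum x A = a" using ne by (simp add: x_def)
  have "sum x C = (\<Sum>k\<in>C. c / card C)"
    using fin(3) by (intro sum.cong) (auto simp: x_def)
  then have sC: "sum x C = c" using ne by simp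
  \<comment> \<open>The smaller of the two margins that the sources \<open>i\<close> and
    \<open>j\<close> have before leaving their range.\<close>
  define \<delta> where "\<delta> = min (b - \<bar>a / card A\<bar>) (b - \<bar>c / card C\<bar>)"
  have ac: "\<bar>a / card A\<bar> < b" "\<bar>c / card C\<bar> < b"
    using a c ne by (auto simp: abs_divide field_simps)
  then have "\<delta> > 0" by (simp add: \<delta>_def)
  have xi: "x i = a / card A" "x j = c / card C" using ij fin(3) by (auto simp: x_def)
  have \<delta>: "\<delta> \<le> b - \<bar>x i\<bar>" "\<delta> \<le> b - \<bar>x j\<bar>" by (auto simp: xi \<delta>_def)
  \<comment> \<open>A block of \<open>n\<close> sources has \<open>n\<close> times the room of a
    single source, so a shock that fits one source fits the block total.\<close>
  have near: "{y-\<delta>..y+\<delta>} \<subseteq> {-(real n * b)..real n * b}" if "n > 0" "\<delta> \<le> b - \<bar>y / n\<bar>" for y n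
  proof -
    have "\<delta> \<le> real n * \<delta>" using \<open>\<delta> > 0\<close> \<open>n > 0\<close> by simp
    also have "\<dots> \<le> real n * (b - \<bar>y / n\<bar>)" using that by (intro mult_left_mono) auto
    also have "\<dots> = real n * b - \<bar>y\<bar>" using \<open>n > 0\<close> by (simp add: algebra_simps abs_divide)
    finally show ?thesis by auto
  qed
  have nA: "{a-\<delta>..a+\<delta>} \<subseteq> {-(real (card A) * b)..real (card A) * b}"
    and nC: "{c-\<delta>..c+\<delta>} \<subseteq> {-(real (card C) * b)..real (card C) * b}"
    using \<delta> ne by (intro near; simp add: xi)+
  have iA: "index_fun (real (card A) * b) (vA A)" and iC: "index_fun (real (card C) * b) (vA C)"
    using vA AC by auto
  have CE: "CE (real (card A) * b) (map_pmf (\<lambda>t. a + t) e) (vA A) - a =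
      CE (real (card C) * b) (map_pmf (\<lambda>t. c + t) e) (vA C) - c" if e: "set_pmf e \<subseteq> {-\<delta>, \<delta>}" for e
  proof (rule CE_shift_eq_of_dominance[OF part vA R dom AC ij, of x e, unfolded sA sC])
    show "finite (set_pmf e)" using e finite_subset by blast
    show "x k \<in> {-b..b}" for k using ac \<open>b > 0\<close>
      by (auto simp: x_def abs_less_iff simp del: abs_divide)
    have "\<bar>t\<bar> \<le> \<delta>" if "t \<in> set_pmf e" for t using e that \<open>\<delta> > 0\<close> by auto
    then show "x i + t \<in> {-b..b}" "x j + t \<in> {-b..b}" if "t \<in> set_pmf e" for t
      using \<delta> that by fastforce+
  qed
  obtain m n where "m > 0"
    and mn: "\<And>t. \<bar>t\<bar> \<le> \<delta> \<Longrightarrow> vA C (c + t) = m * vA A (a + t) + n"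
    using affine_of_binary_CE_eq[OF iA iC \<open>\<delta> > 0\<close> nA nC CE] by metis
  show ?thesis
    by (rule arrow_pratt_eq_of_affine[OF iA iC \<open>\<delta> > 0\<close> \<open>m > 0\<close> nA nC mn])
qed

lemma CARA_representation_of_dominance:
  assumes part: "partition_on {1..N} P" and "b > 0"
    and vA: "\<forall>A\<in>P. index_fun (real (card A) * b) (vA A)"
    and R: "represents N b
           (\<lambda>p. \<Sum>A\<in>P. CE (real (card A) * b) (total_dist A (marginal A p)) (vA A)) R"
    and dom: "independent_sources_dominance N b R"
    and AC: "A \<in> P" "C \<in> P" "A \<noteq> C"
  shows "\<exists>v. index_fun (real N * b) v \<and> CARA (real N * b) v \<and>
    represents N b (\<lambda>p. \<Sum>A\<in>P. CE (real N * b) (total_dist A (marginal A p)) v) R"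
proof -
  define c where "c = arrow_pratt (real (card A) * b) (vA A) 0"
  note eq = arrow_pratt_eq_of_dominance[OF part \<open>b > 0\<close> vA R dom]
  have sub: "D \<subseteq> {1..N}" "0 < card D" "card D \<le> N" if "D \<in> P" for D
  proof -
    show "D \<subseteq> {1..N}" using part that by (auto simp: partition_on_def)
    then show "0 < card D" "card D \<le> N"
      using part that card_mono[of "{1..N}" D] by (auto simp: partition_on_def card_gt_0_iff intro: finite_subset)
  qed
  have pos: "real (card D) * b > 0" if "D \<in> P" for D using sub[OF that] \<open>b > 0\<close> by simp
  \<comment> \<open>Dominance compares distinct blocks only. For \<open>A\<close> itself the points
    \<open>y\<close> and 0 are therefore both compared with the point 0 of \<open>C\<close>.\<close>
  have ap: "arrow_pratt (real (card D) * b) (vA D) y = c"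
    if "D \<in> P" and y: "\<bar>y\<bar> < real (card D) * b" for D y
  proof (cases "D = A")
    case False
    then show ?thesis using eq[OF AC(1) that(1), of 0 y] pos AC y by (simp add: c_def)
  next
    case True
    then show ?thesis
      using eq[OF AC, of y 0] eq[OF AC, of 0 0] pos AC y by (simp add: c_def)
  qed
  have "N > 0" using sub[OF AC(1)] by linarith
  then have NB: "real N * b > 0" using \<open>b > 0\<close> by simp
  note v = index_fun_cara_fun[OF NB, of c]
  \<comment> \<open>Both sides equal \<open>cara_CE c\<close>, so enlarging the index's domain to
    the common interval changes no value of the functional.\<close>
  have "CE (real N * b) (total_dist D p) (cara_fun c) = CE (real (card D) * b) (total_dist D p) (vA D)"
    if D: "D \<in> P" and p: "p \<in> lotteries (box_on b {1..N})" for D p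
  proof -
    have "CE (real (card D) * b) (total_dist D p) (vA D) = cara_CE c (total_dist D p)"
      using sub[OF D] vA ap[OF D] D p
      by (intro CE_eq_cara_CE pos total_dist_lottery[where I = "{1..N}"]) auto
    moreover have "total_dist D p \<in> lotteries {-(real N * b)..real N * b}"
      using sub[OF D] p \<open>b > 0\<close> by (intro total_dist_lottery[where I = "{1..N}"]) auto
    then have "CE (real N * b) (total_dist D p) (cara_fun c) = cara_CE c (total_dist D p)"
      using strict_mono_cara_fun cara_fun_cara_CE CE_works[OF v(1)]
      by (metis (no_types, lifting) lotteries_iff strict_mono_eq)
    ultimately show ?thesis by simp
  qed
  then have "represents N b (\<lambda>p. \<Sum>A\<in>P. CE (real N * b) (total_dist A (marginal A p)) (cara_fun c)) R"
    using R by (simp add: represents_def total_dist_marginal)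
  with v show ?thesis by blast
qed

section \<open>Assembly: one block leads to expected utility, several lead to CARA, and either form
  yields dominance\<close>

theorem proposition2:
  fixes N :: nat and b :: real and R :: preference
    and P :: "nat set set" and vA :: "nat set \<Rightarrow> real \<Rightarrow> real"
  assumes "N > 1" and "b > 0"
    and "partition_on {1..N} P"
    and "\<forall>A\<in>P. index_fun (real (card A) * b) (vA A)"
    and "represents N b
           (\<lambda>p. \<Sum>A\<in>P. CE (real (card A) * b) (total_dist A (marginal A p)) (vA A)) R"
  shows "independent_sources_dominance N b R \<longleftrightarrow>
           (\<exists>v. index_fun (real N * b) v \<and>
              represents N b (\<lambda>p. measure_pmf.expectation (total_dist {1..N} p) v) R) \<or>
           (\<exists>v. index_fun (real N * b) v \<and> CARA (real N * b) v \<and>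
              represents N b
                (\<lambda>p. \<Sum>A\<in>P. CE (real N * b) (total_dist A (marginal A p)) v) R)"
    (is "_ \<longleftrightarrow> ?EU \<or> ?CARA")
proof
  assume dom: "independent_sources_dominance N b R"
  show "?EU \<or> ?CARA"
  proof (cases "\<exists>A\<in>P. \<exists>C\<in>P. A \<noteq> C")
    case True
    then show ?thesis
      using CARA_representation_of_dominance[OF assms(3,2,4,5) dom] by blast
  next
    \<comment> \<open>With a single block the functional is one certainty equivalent of the grand
      total, which orders lotteries exactly as the expectation of the block's index does.\<close>
    case False
    have "\<Union>P = {1..N}" using assms(3) by (simp add: partition_on_def)
    moreover from this obtain A where "A \<in> P" using \<open>N > 1\<close> by fastforce
    moreover from this False have "P = {A}" by blast
    ultimately have P: "P = {{1..N}}" by simp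
    let ?v = "vA {1..N}"
    have v: "index_fun (real N * b) ?v" using assms(4) by (simp add: P)
    have "represents N b (\<lambda>p. measure_pmf.expectation (total_dist {1..N} p) ?v) R"
      using assms(5) by (simp add: P represents_def total_dist_marginal CE_le_iff[OF v]
          total_dist_lottery[OF _ order_refl])
    with v show ?thesis by blast
  qed
next
  assume "?EU \<or> ?CARA"
  then show "independent_sources_dominance N b R"
  proof (elim disjE exE conjE)
    fix v
    assume "index_fun (real N * b) v"
      and "represents N b (\<lambda>p. measure_pmf.expectation (total_dist {1..N} p) v) R"
    then show ?thesis
      using \<open>N > 1\<close> by (intro dominance_of_expected_utility[of N b v])
        (auto simp: represents_def dest: index_funD(2))
  next
    fix v
    assume "index_fun (real N * b) v" "CARA (real N * b) v"
      "represents N b (\<lambda>p. \<Sum>A\<in>P. CE (real N * b) (total_dist A (marginal A p)) v) R"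
    then show ?thesis
      using assms(1-3) by (intro dominance_of_CARA[of N b P v R]) auto
  qed
qed

end
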